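(* Let $n$ and $m$ be integers with $n\geq3$ and $m\geq3$. Then (1) $spvc(K_n\times K_m)=pvc_2(K_n\times K_m)=1$; (2) $spvc(K_2\times K_m)=pvc_2(K_2\times K_m)=2$.
   Context: All graphs are simple, finite and undirected; $K_n$ is the complete graph on $n$ vertices. The direct product $G\times H$ has vertex set $V(G)\times V(H)$, with $(g,h)$ adjacent to $(g',h')$ iff $gg'\in E(G)$ and $hh'\in E(H)$. A set of paths between two vertices is called disjoint if they are internally vertex-disjoint. In a vertex-colored graph, a path is vertex-proper if any two adjacent internal vertices of the path receive different colors. A vertex-colored graph is proper vertex $2$-connected if any two vertices are joined by $2$ disjoint vertex-proper paths; for a $2$-connected graph $G$, $pvc_2(G)$ is the smallest number of colors ($\ge1$) in a vertex-coloring making $G$ proper vertex $2$-connected. A $u$-$v$ geodesic is a $u$-$v$ path of length $d(u,v)$; $spvc(G)$ is the smallest number of colors in a vertex-coloring of connected $G$ such that any two vertices $u,v$ are joined by a vertex-proper $u$-$v$ geodesic, with $spvc(G)=0$ for complete $G$. *)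

theory Defs
  imports
    "Graph_Theory.Graph_Theory"
    "HOL-Library.Extended_Nat"
begin

text \<open>
  A finite simple undirected graph is a \<^locale>\<open>pair_graph\<close>: a finite, loopfree, symmetric
  digraph whose arcs are pairs of vertices.  A coloring is a function to \<^typ>\<open>nat\<close>; only its
  values on the vertex set matter, and their number is the number of colors.
\<close>

definition direct_product ::
    "'a pair_pre_digraph \<Rightarrow> 'b pair_pre_digraph \<Rightarrow> ('a \<times> 'b) pair_pre_digraph"
    (infixl \<open>\<times>\<^sub>G\<close> 75) where
  "G \<times>\<^sub>G H = \<lparr> pverts = pverts G \<times> pverts H,
     parcs = {((g, h), (g', h')). (g, g') \<in> parcs G \<and> (h, h') \<in> parcs H} \<rparr>"

lemma pair_graph_direct_product:
  assumes "pair_graph G" "pair_graph H"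
  shows "pair_graph (G \<times>\<^sub>G H)"
proof -
  interpret G: pair_graph G by fact
  interpret H: pair_graph H by fact
  have "parcs (G \<times>\<^sub>G H) \<subseteq> (pverts G \<times> pverts H) \<times> (pverts G \<times> pverts H)"
    by (auto simp: direct_product_def G.wellformed' H.wellformed'
        dest: G.in_arcsD1 G.in_arcsD2 H.in_arcsD1 H.in_arcsD2)
  moreover have "finite ((pverts G \<times> pverts H) \<times> (pverts G \<times> pverts H))"
    by simp
  ultimately have "finite (parcs (G \<times>\<^sub>G H))"
    by (rule finite_subset)
  then show ?thesis
    by unfold_locales
      (auto simp: direct_product_def symmetric_def sym_def
        dest: G.in_arcsD1 G.in_arcsD2 H.in_arcsD1 H.in_arcsD2
          G.arcs_symmetric H.arcs_symmetric G.no_loops' H.no_loops')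
qed

definition path_between :: "'a pair_pre_digraph \<Rightarrow> 'a \<Rightarrow> 'a \<Rightarrow> 'a list \<Rightarrow> bool" where
  "path_between G u v p \<longleftrightarrow> vpath p (with_proj G) \<and> hd p = u \<and> last p = v"

definition internal_verts :: "'a list \<Rightarrow> 'a list" where
  "internal_verts p = butlast (tl p)"

text \<open>The distance is the minimal cost of a walk when every arc has weight 1.\<close>

definition graph_dist :: "'a pair_pre_digraph \<Rightarrow> 'a \<Rightarrow> 'a \<Rightarrow> ereal" where
  "graph_dist G u v = wf_digraph.\<mu> (with_proj G) (\<lambda>_. 1) u v"

definition geodesic :: "'a pair_pre_digraph \<Rightarrow> 'a \<Rightarrow> 'a \<Rightarrow> 'a list \<Rightarrow> bool" where
  "geodesic G u v p \<longleftrightarrow>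
     path_between G u v p \<and> ereal (real (vwalk_length p)) = graph_dist G u v"

definition vertex_proper :: "('a \<Rightarrow> nat) \<Rightarrow> 'a list \<Rightarrow> bool" where
  "vertex_proper c p \<longleftrightarrow> successively (\<lambda>x y. c x \<noteq> c y) (internal_verts p)"

text \<open>
  The clause \<open>p \<noteq> q\<close> is needed for adjacent end vertices: the path consisting of a single edge
  has no internal vertices, and must not be counted twice.
\<close>

definition proper_vertex_2_connected :: "'a pair_pre_digraph \<Rightarrow> ('a \<Rightarrow> nat) \<Rightarrow> bool" where
  "proper_vertex_2_connected G c \<longleftrightarrow>
     (\<forall>u \<in> pverts G. \<forall>v \<in> pverts G. u \<noteq> v \<longrightarrow>
       (\<exists>p q. p \<noteq> q \<and> path_between G u v p \<and> path_between G u v q \<and>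
         set (internal_verts p) \<inter> set (internal_verts q) = {} \<and>
         vertex_proper c p \<and> vertex_proper c q))"

definition strong_proper_vertex_connected :: "'a pair_pre_digraph \<Rightarrow> ('a \<Rightarrow> nat) \<Rightarrow> bool" where
  "strong_proper_vertex_connected G c \<longleftrightarrow>
     (\<forall>u \<in> pverts G. \<forall>v \<in> pverts G. u \<noteq> v \<longrightarrow>
       (\<exists>p. geodesic G u v p \<and> vertex_proper c p))"

text \<open>
  Both numbers are taken in \<^typ>\<open>enat\<close>: a graph without a suitable coloring (one that is
  not 2-connected, respectively not connected) gets \<open>\<infinity>\<close>, so a finite value is
  attained by some coloring.  At least one color is used as soon as there is a vertex.
\<close>

definition pvc2 :: "'a pair_pre_digraph \<Rightarrow> enat" where
  "pvc2 G = (INF c \<in> {c. proper_vertex_2_connected G c}. enat (card (c ` pverts G)))"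

definition spvc :: "'a pair_pre_digraph \<Rightarrow> enat" where
  "spvc G =
     (if complete_digraph (card (pverts G)) (with_proj G) then 0
      else INF c \<in> {c. strong_proper_vertex_connected G c}. enat (card (c ` pverts G)))"

end

theory Submission
  imports Defs
begin

text \<open>
  In \<open>K\<^sub>n \<times> K\<^sub>m\<close> two adjacent vertices have a common neighbor and two nonadjacent ones have two,
  so paths with at most one internal vertex suffice and a single color does.
  In the bipartite graph \<open>K\<^sub>2 \<times> K\<^sub>m\<close> the bipartition is a coloring for which every path is proper,
  and the graph is 2-connected; one color is not enough because the vertices \<open>(a, x)\<close>
  and \<open>(b, x)\<close> are at distance 3, while a proper path in one color has length at most 2.
\<close>

section \<open>Evaluating the two color numbers\<close>

lemma INF_enat_eqI:
  assumes "P c" "f c = k" "\<And>c. P c \<Longrightarrow> k \<le> f c"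
  shows "(INF c \<in> {c. P c}. enat (f c)) = enat k"
proof (rule antisym)
  show "(INF c \<in> {c. P c}. enat (f c)) \<le> enat k"
    using assms(1,2) by (intro INF_lower2[of c]) auto
  show "enat k \<le> (INF c \<in> {c. P c}. enat (f c))"
    using assms(3) by (intro INF_greatest) auto
qed

lemma pvc2_eqI:
  assumes "proper_vertex_2_connected G c" "card (c ` pverts G) = k"
    and "\<And>c. proper_vertex_2_connected G c \<Longrightarrow> k \<le> card (c ` pverts G)"
  shows "pvc2 G = enat k"
  unfolding pvc2_def by (rule INF_enat_eqI) (use assms in auto)

text \<open>The nonadjacent pair \<open>u\<close>, \<open>v\<close> rules out completeness, so the
  special value 0 in \<open>spvc\<close> does not apply and only the infimum has to be
  computed.\<close>

lemma spvc_eqI: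
  assumes "u \<in> pverts G" "v \<in> pverts G" "u \<noteq> v" "(u, v) \<notin> parcs G"
    and "strong_proper_vertex_connected G c" "card (c ` pverts G) = k"
    and "\<And>c. strong_proper_vertex_connected G c \<Longrightarrow> k \<le> card (c ` pverts G)"
  shows "spvc G = enat k"
proof -
  have "\<not> complete_digraph (card (pverts G)) (with_proj G)"
    using assms(1-4) by (auto simp: complete_digraph_pair_def)
  moreover have "(INF c \<in> {c. strong_proper_vertex_connected G c}. enat (card (c ` pverts G))) = enat k"
    by (rule INF_enat_eqI) (use assms in auto)
  ultimately show ?thesis
    unfolding spvc_def by simp
qed

section \<open>Explicit paths, their lengths and their colors\<close>

lemma path_between_simps [simp]:
  "path_between G u v [x] \<longleftrightarrow> x = u \<and> x = v \<and> x \<in> pverts G"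
  "path_between G u v (x # y # p) \<longleftrightarrow>
     x = u \<and> u \<in> pverts G \<and> (u, y) \<in> parcs G \<and> u \<notin> set (y # p) \<and> path_between G y v (y # p)"
  by (auto simp: path_between_def vpath_def vwalk_def)

lemma internal_verts_Cons_Cons [simp]:
  "internal_verts (x # y # p) = butlast (y # p)"
  by (simp add: internal_verts_def)

text \<open>The distance is an infimum of costs over arc walks, whereas paths are vertex lists.
  Turning \<open>p\<close> into an arc walk with \<open>length p - 1\<close> arcs shows that the
  bound \<open>le\<close> is attained.\<close>

lemma geodesicI:
  assumes "wf_digraph (with_proj G)" and p: "path_between G u v p"
    and le: "\<And>q. pre_digraph.awalk (with_proj G) u q v \<Longrightarrow> length p - 1 \<le> length q"
  shows "geodesic G u v p"
proof -
  interpret wf_digraph "with_proj G" by fact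
  have cost: "awalk_cost (\<lambda>_. 1) q = real (length q)" for q :: "('a \<times> 'a) list"
    by (induction q) auto
  have walk: "vwalk p (with_proj G)" "hd p = u" "last p = v"
    using p by (auto simp: path_between_def vpath_def)
  obtain q where q: "awalk u q v" "length q = length p - 1"
  proof -
    \<comment> \<open>The ends are written as \<open>hd p\<close> and \<open>last p\<close> so that
      the claim carries over to tails of \<open>p\<close> in the induction.\<close>
    have "\<exists>q. awalk (hd p) q (last p) \<and> length q = length p - 1"
      using walk(1)
    proof (induction rule: vwalk_induct)
      case (Base u)
      then show ?case by (auto simp: awalk_Nil_iff intro!: exI[of _ "[]"])
    next
      case (Cons u v es)
      then obtain q where "awalk v q (last (v # es))" "length q = length es"
        by auto
      with Cons(1) show ?case
        using awalk_Cons_iff[of u "(u, v)" q "last (v # es)"]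
        by (intro exI[of _ "(u, v) # q"]) auto
    qed
    then show ?thesis using walk that by blast
  qed
  have "\<mu> (\<lambda>_. 1) u v = ereal (real (length p - 1))"
    unfolding \<mu>_def cost
  proof (rule INF_eqI)
    show "ereal (real (length p - 1)) \<le> ereal (real (length r))" if "r \<in> {p. awalk u p v}" for r
      using le[of r] that by simp
    show "y \<le> ereal (real (length p - 1))"
      if "\<And>r. r \<in> {p. awalk u p v} \<Longrightarrow> y \<le> ereal (real (length r))" for y
      using that[of q] q by simp
  qed
  then show ?thesis
    using p by (simp add: geodesic_def graph_dist_def)
qed

lemma geodesic_edge:
  assumes "wf_digraph (with_proj G)" "u \<noteq> v" "path_between G u v [u, v]"
  shows "geodesic G u v [u, v]"
proof (rule geodesicI[OF assms(1,3)])
  interpret wf_digraph "with_proj G" by fact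
  fix q assume "awalk u q v"
  with \<open>u \<noteq> v\<close> show "length [u, v] - 1 \<le> length q"
    by (cases q) (auto simp: awalk_Nil_iff)
qed

lemma geodesic_via_common_neighbor:
  assumes "wf_digraph (with_proj G)" "u \<noteq> v" "(u, v) \<notin> parcs G" "path_between G u v [u, w, v]"
  shows "geodesic G u v [u, w, v]"
proof (rule geodesicI[OF assms(1,4)])
  interpret wf_digraph "with_proj G" by fact
  fix q assume "awalk u q v"
  with assms(2,3) show "length [u, w, v] - 1 \<le> length q"
    by (cases q; cases "tl q") (auto simp: awalk_Nil_iff awalk_Cons_iff)
qed

text \<open>Walks with zero, one and two arcs are excluded in turn by \<open>u \<noteq> v\<close>,
  by nonadjacency and by the absence of a common neighbor.\<close>

lemma geodesic_length_3:
  assumes "wf_digraph (with_proj G)" "u \<noteq> v" "(u, v) \<notin> parcs G"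
    and "\<And>w. (u, w) \<in> parcs G \<Longrightarrow> (w, v) \<notin> parcs G"
    and "path_between G u v [u, w, z, v]"
  shows "geodesic G u v [u, w, z, v]"
proof (rule geodesicI[OF assms(1,5)])
  interpret wf_digraph "with_proj G" by fact
  fix q assume "awalk u q v"
  with assms(2-4) show "length [u, w, z, v] - 1 \<le> length q"
    by (cases q; cases "tl q"; cases "tl (tl q)") (auto simp: awalk_Nil_iff awalk_Cons_iff)
qed

text \<open>The hypotheses keep \<open>u\<close> and \<open>v\<close> at distance at least 3, so a
  path between them has two consecutive internal vertices, which properness forces to differ in
  color.\<close>

lemma two_le_card_colors:
  assumes "finite (pverts G)" "u \<in> pverts G" "u \<noteq> v" "(u, v) \<notin> parcs G"
    and no_common: "\<And>w. (u, w) \<in> parcs G \<Longrightarrow> (w, v) \<notin> parcs G"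
    and p: "path_between G u v p" "vertex_proper c p"
  shows "2 \<le> card (c ` pverts G)"
proof (rule ccontr)
  assume "\<not> 2 \<le> card (c ` pverts G)"
  then have "card (c ` pverts G) \<le> Suc 0" by simp
  then have "\<forall>a \<in> c ` pverts G. \<forall>b \<in> c ` pverts G. a = b"
    using assms(1) by (metis card_le_Suc0_iff_eq finite_imageI)
  then have mono: "c x = c y" if "x \<in> pverts G" "y \<in> pverts G" for x y
    using that by blast
  have sub: "set p \<subseteq> pverts G" and "p \<noteq> []"
    using p(1) by (auto simp: path_between_def vpath_def vwalk_def)
  then obtain x p1 where 1: "p = x # p1" by (cases p) auto
  with p(1) \<open>u \<noteq> v\<close> obtain y p2 where 2: "p1 = y # p2" by (cases p1) auto
  with 1 p(1) \<open>(u, v) \<notin> parcs G\<close> obtain z p3 where 3: "p2 = z # p3" by (cases p2) auto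
  \<comment> \<open>The fourth vertex \<open>w\<close> keeps \<open>z\<close> from being the end of
    the path, so both \<open>y\<close> and \<open>z\<close> are internal.\<close>
  with 1 2 p(1) no_common obtain w p4 where "p3 = w # p4" by (cases p3) auto
  with 1 2 3 p(2) have "c y \<noteq> c z" by (auto simp: vertex_proper_def split: if_splits)
  with mono[of y z] sub 1 2 3 show False by auto
qed

section \<open>Adjacency and common neighbors in products of complete graphs\<close>

lemma ex_third_element:
  assumes "3 \<le> card A"
  shows "\<exists>z \<in> A. z \<noteq> x \<and> z \<noteq> y"
proof (rule ccontr)
  assume "\<not> ?thesis"
  then have "A \<subseteq> {x, y}" by auto
  then have "card A \<le> card {x, y}" by (intro card_mono) auto
  also have "\<dots> \<le> 2" by (simp add: card_insert_if)
  finally show False using assms by simp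
qed

lemma direct_product_complete:
  assumes "complete_digraph n (with_proj G)" "complete_digraph m (with_proj H)"
  shows "pverts (G \<times>\<^sub>G H) = pverts G \<times> pverts H"
    and "((g, h), (g', h')) \<in> parcs (G \<times>\<^sub>G H) \<longleftrightarrow>
      g \<in> pverts G \<and> g' \<in> pverts G \<and> g \<noteq> g' \<and> h \<in> pverts H \<and> h' \<in> pverts H \<and> h \<noteq> h'"
    and "finite (pverts (G \<times>\<^sub>G H))"
    and "wf_digraph (with_proj (G \<times>\<^sub>G H))"
proof -
  show "pverts (G \<times>\<^sub>G H) = pverts G \<times> pverts H"
    by (simp add: direct_product_def)
  show "((g, h), (g', h')) \<in> parcs (G \<times>\<^sub>G H) \<longleftrightarrow>
      g \<in> pverts G \<and> g' \<in> pverts G \<and> g \<noteq> g' \<and> h \<in> pverts H \<and> h' \<in> pverts H \<and> h \<noteq> h'"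
    using assms by (auto simp: direct_product_def complete_digraph_pair_def)
  interpret pair_graph "G \<times>\<^sub>G H"
    using assms by (intro pair_graph_direct_product pair_graphI_complete)
  show "finite (pverts (G \<times>\<^sub>G H))" by (rule pair_finite_verts)
  show "wf_digraph (with_proj (G \<times>\<^sub>G H))" by unfold_locales
qed

text \<open>A vertex that avoids both coordinates of \<open>u\<close> and of \<open>v\<close> is
  adjacent to both. If \<open>u\<close> and \<open>v\<close> agree in one coordinate, only one value
  has to be avoided there, which leaves room for a second common neighbor. If they agree in none,
  they are adjacent and the edge itself can serve as the second path.\<close>

lemma direct_product_complete_common_neighbors:
  assumes Kn: "complete_digraph n (with_proj G)" and Km: "complete_digraph m (with_proj H)"
    and "3 \<le> n" "3 \<le> m"
    and uv: "u \<in> pverts (G \<times>\<^sub>G H)" "v \<in> pverts (G \<times>\<^sub>G H)" "u \<noteq> v"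
  obtains w w' where "path_between (G \<times>\<^sub>G H) u v [u, w, v]"
    "(u, v) \<in> parcs (G \<times>\<^sub>G H) \<or> path_between (G \<times>\<^sub>G H) u v [u, w', v] \<and> w \<noteq> w'"
proof -
  note [simp] = direct_product_complete(1,2)[OF Kn Km]
  have ex: "\<exists>z \<in> pverts G. z \<noteq> x \<and> z \<noteq> y" "\<exists>z \<in> pverts H. z \<noteq> x' \<and> z \<noteq> y'" for x y x' y'
    using assms by (auto intro!: ex_third_element simp: complete_digraph_pair_def)
  obtain g h g' h' where [simp]: "u = (g, h)" "v = (g', h')" by (cases u; cases v)
  obtain a b where ab: "a \<in> pverts G" "a \<noteq> g" "a \<noteq> g'" "b \<in> pverts H" "b \<noteq> h" "b \<noteq> h'"
    using ex by meson
  consider "g \<noteq> g'" "h \<noteq> h'" | "g = g'" | "h = h'" by blast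
  then show ?thesis
  proof cases
    case 1
    \<comment> \<open>Here \<open>u\<close> and \<open>v\<close> are adjacent, so the value of
      \<open>w'\<close> is left open.\<close>
    then show ?thesis using uv ab by (intro that[of "(a, b)"]) auto
  next
    case 2
    obtain a' where "a' \<in> pverts G" "a' \<noteq> g" "a' \<noteq> a" using ex by meson
    then show ?thesis using 2 uv ab by (intro that[of "(a, b)" "(a', b)"]) auto
  next
    case 3
    obtain b' where "b' \<in> pverts H" "b' \<noteq> h" "b' \<noteq> b" using ex by meson
    then show ?thesis using 3 uv ab by (intro that[of "(a, b)" "(a, b')"]) auto
  qed
qed

lemma path_between_edge:
  assumes "wf_digraph (with_proj G)" "(u, v) \<in> parcs G" "u \<noteq> v"
  shows "path_between G u v [u, v]"
proof -
  have "pair_wf_digraph G" using assms(1) by (simp only: wf_digraph_wp_iff)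
  then have "u \<in> pverts G" "v \<in> pverts G"
    using assms(2) by (auto dest: pair_wf_digraph.wellformed')
  then show ?thesis using assms(2,3) by simp
qed

section \<open>Both factors with at least three vertices\<close>

lemma direct_product_complete_one_color:
  assumes Kn: "complete_digraph n (with_proj G)" and Km: "complete_digraph m (with_proj H)"
    and nm: "3 \<le> n" "3 \<le> m"
  shows "spvc (G \<times>\<^sub>G H) = 1" and "pvc2 (G \<times>\<^sub>G H) = 1"
proof -
  let ?P = "G \<times>\<^sub>G H" and ?c = "\<lambda>_ :: 'a \<times> 'b. 0 :: nat"
  note dp [simp] = direct_product_complete[OF Kn Km]
  note nbrs = direct_product_complete_common_neighbors[OF Kn Km nm]
  have card: "3 \<le> card (pverts G)" "3 \<le> card (pverts H)"
    using Kn Km nm by (auto simp: complete_digraph_pair_def)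
  obtain g where g: "g \<in> pverts G" using ex_third_element[OF card(1)] by blast
  obtain h where h: "h \<in> pverts H" using ex_third_element[OF card(2)] by blast
  obtain h' where h': "h' \<in> pverts H" "h' \<noteq> h" using ex_third_element[OF card(2)] by blast
  have ge: "1 \<le> card (c ` pverts ?P)" for c :: "'a \<times> 'b \<Rightarrow> nat"
  proof -
    have "card (c ` pverts ?P) > 0"
      unfolding card_gt_0_iff using g h dp(3) by auto
    then show ?thesis by simp
  qed
  have eq: "card (?c ` pverts ?P) = 1"
    using g h by (auto simp: image_constant_conv)
  \<comment> \<open>Geodesics with at most one internal vertex are proper under any coloring, hence
    under the constant one.\<close>
  have conn: "strong_proper_vertex_connected ?P ?c"
    unfolding strong_proper_vertex_connected_def
  proof (intro ballI impI)
    fix u v assume uv: "u \<in> pverts ?P" "v \<in> pverts ?P" "u \<noteq> v"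
    obtain w where w: "path_between ?P u v [u, w, v]" using nbrs[OF uv] by blast
    show "\<exists>p. geodesic ?P u v p \<and> vertex_proper ?c p"
    proof (cases "(u, v) \<in> parcs ?P")
      case True
      then have "geodesic ?P u v [u, v]"
        using uv by (intro geodesic_edge path_between_edge dp(4))
      then show ?thesis by (intro exI[of _ "[u, v]"]) (simp add: vertex_proper_def)
    next
      case False
      then have "geodesic ?P u v [u, w, v]"
        using uv w by (intro geodesic_via_common_neighbor dp(4))
      then show ?thesis by (intro exI[of _ "[u, w, v]"]) (simp add: vertex_proper_def)
    qed
  qed
  have conn2: "proper_vertex_2_connected ?P ?c"
    unfolding proper_vertex_2_connected_def
  proof (intro ballI impI)
    fix u v assume uv: "u \<in> pverts ?P" "v \<in> pverts ?P" "u \<noteq> v"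
    obtain w w' where w: "path_between ?P u v [u, w, v]"
      and w': "(u, v) \<in> parcs ?P \<or> path_between ?P u v [u, w', v] \<and> w \<noteq> w'"
      by (rule nbrs[OF uv])
    \<comment> \<open>The second path is the edge when there is one and runs through the other
      common neighbor otherwise; either way it shares no internal vertex with the path through
      \<open>w\<close>.\<close>
    define q where "q = (if (u, v) \<in> parcs ?P then [u, v] else [u, w', v])"
    have "path_between ?P u v q"
      using w' uv path_between_edge[OF dp(4), of u v] by (auto simp: q_def simp del: path_between_simps)
    with w w' show "\<exists>p q. p \<noteq> q \<and> path_between ?P u v p \<and> path_between ?P u v q \<and>
         set (internal_verts p) \<inter> set (internal_verts q) = {} \<and>
         vertex_proper ?c p \<and> vertex_proper ?c q"
      by (intro exI[of _ "[u, w, v]"] exI[of _ q])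
        (auto simp: q_def vertex_proper_def simp del: path_between_simps)
  qed
  have "spvc ?P = enat 1"
    \<comment> \<open>The two vertices agree in the first coordinate, so they are not
      adjacent.\<close>
    by (rule spvc_eqI[of "(g, h)" _ "(g, h')"]) (use g h h' conn eq ge in auto)
  then show "spvc ?P = 1" by (simp add: one_enat_def)
  have "pvc2 ?P = enat 1"
    by (rule pvc2_eqI) (use conn2 eq ge in auto)
  then show "pvc2 ?P = 1" by (simp add: one_enat_def)
qed

section \<open>The bipartite product with a two-vertex factor\<close>

lemma direct_product_K2_complete_two_colors:
  assumes K2: "complete_digraph 2 (with_proj G)" and Km: "complete_digraph m (with_proj H)"
    and m: "3 \<le> m"
  shows "spvc (G \<times>\<^sub>G H) = 2" and "pvc2 (G \<times>\<^sub>G H) = 2"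
proof -
  let ?P = "G \<times>\<^sub>G H"
  note dp [simp] = direct_product_complete[OF K2 Km]
  obtain a b where ab [simp]: "pverts G = {a, b}" "a \<noteq> b"
    using K2 by (auto simp: complete_digraph_pair_def card_2_iff)
  \<comment> \<open>The color records the side of the bipartition. Every arc changes sides, so
    adjacent vertices always differ in color.\<close>
  define c where "c = (\<lambda>(g, h :: 'b). if g = a then 0 else 1 :: nat)"
  have c [simp]: "c (g, h) = (if g = a then 0 else 1)" for g h
    by (simp add: c_def)
  have third: "\<exists>z \<in> pverts H. z \<noteq> x \<and> z \<noteq> y" for x y
    using Km m by (auto intro!: ex_third_element simp: complete_digraph_pair_def)
  obtain h where h: "h \<in> pverts H" using third by blast
  have nonadj: "(a, h) \<in> pverts ?P" "(b, h) \<in> pverts ?P" "(a, h) \<noteq> (b, h)"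
    "((a, h), (b, h)) \<notin> parcs ?P"
    using h by auto
  \<comment> \<open>Neighbors of \<open>(a, h)\<close> have first coordinate \<open>b\<close>, and
    those of \<open>(b, h)\<close> have first coordinate \<open>a\<close>.\<close>
  have no_common: "(w, (b, h)) \<notin> parcs ?P" if "((a, h), w) \<in> parcs ?P" for w
    using that by (cases w) auto
  have ge: "2 \<le> card (c' ` pverts ?P)"
    if "path_between ?P (a, h) (b, h) p" "vertex_proper c' p" for c' p
    by (rule two_le_card_colors[OF dp(3) nonadj(1,3,4) no_common that])
  have "c ` pverts ?P = {0, 1}"
    using h by (force simp: c_def image_iff)
  then have eq: "card (c ` pverts ?P) = 2" by simp
  \<comment> \<open>Two distinct vertices lie on one side, or form a nonadjacent pair across the
    sides, or are adjacent. In the first case \<open>j\<close> names the opposite side, which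
    supplies the intermediate vertices.\<close>
  have side_cases: thesis
    if "u \<in> pverts ?P" "v \<in> pverts ?P" "u \<noteq> v"
      and "\<And>i j x y. \<lbrakk>u = (i, x); v = (i, y); x \<noteq> y; {i, j} = {a, b}; i \<noteq> j;
        x \<in> pverts H; y \<in> pverts H\<rbrakk> \<Longrightarrow> thesis"
      and "\<And>i j x. \<lbrakk>u = (i, x); v = (j, x); {i, j} = {a, b}; i \<noteq> j; x \<in> pverts H\<rbrakk> \<Longrightarrow> thesis"
      and "\<And>i j x y. \<lbrakk>u = (i, x); v = (j, y); x \<noteq> y; {i, j} = {a, b}; i \<noteq> j;
        x \<in> pverts H; y \<in> pverts H\<rbrakk> \<Longrightarrow> thesis"
    for u v thesis
  proof -
    obtain i x j y where uv: "u = (i, x)" "v = (j, y)" by (cases u; cases v)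
    then have mem: "i \<in> {a, b}" "j \<in> {a, b}" "x \<in> pverts H" "y \<in> pverts H"
      using that(1,2) by auto
    consider "i = j" | "i \<noteq> j" "x = y" | "i \<noteq> j" "x \<noteq> y" by blast
    then show thesis
    proof cases
      case 1
      show thesis
        by (rule that(4)[of i x y "if i = a then b else a"]) (use 1 uv mem that(3) in auto)
    next
      case 2
      then have "{i, j} = {a, b}" using mem by auto
      then show thesis using 2 uv mem by (intro that(5)) auto
    next
      case 3
      then have "{i, j} = {a, b}" using mem by auto
      then show thesis using 3 uv mem by (intro that(6))
    qed
  qed
  have conn: "strong_proper_vertex_connected ?P c"
    unfolding strong_proper_vertex_connected_def
  proof (intro ballI impI)
    fix u v assume uv: "u \<in> pverts ?P" "v \<in> pverts ?P" "u \<noteq> v"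
    show "\<exists>p. geodesic ?P u v p \<and> vertex_proper c p"
    proof (rule side_cases[OF uv])
      fix i j x y
      assume *: "u = (i, x)" "v = (i, y)" "x \<noteq> y" "{i, j} = {a, b}" "i \<noteq> j"
        "x \<in> pverts H" "y \<in> pverts H"
      obtain z where z: "z \<in> pverts H" "z \<noteq> x" "z \<noteq> y" using third by blast
      have "geodesic ?P u v [u, (j, z), v]"
        by (rule geodesic_via_common_neighbor) (use * z in \<open>auto simp: doubleton_eq_iff\<close>)
      then show ?thesis by (intro exI[of _ "[u, (j, z), v]"]) (simp add: vertex_proper_def)
    next
      fix i j x
      assume *: "u = (i, x)" "v = (j, x)" "{i, j} = {a, b}" "i \<noteq> j" "x \<in> pverts H"
      obtain y where y: "y \<in> pverts H" "y \<noteq> x" using third by blast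
      obtain z where z: "z \<in> pverts H" "z \<noteq> x" "z \<noteq> y" using third by blast
      \<comment> \<open>The sides alternate, and consecutive entries of \<open>x\<close>,
        \<open>y\<close>, \<open>z\<close>, \<open>x\<close> differ. Nothing shorter exists, because
        such a pair is neither adjacent nor has a common neighbor.\<close>
      have "geodesic ?P u v [u, (j, y), (i, z), v]"
        by (rule geodesic_length_3) (use * y z in \<open>auto simp: doubleton_eq_iff\<close>)
      moreover have "vertex_proper c [u, (j, y), (i, z), v]"
        using * by (auto simp: vertex_proper_def doubleton_eq_iff)
      ultimately show ?thesis by blast
    next
      fix i j x y
      assume *: "u = (i, x)" "v = (j, y)" "x \<noteq> y" "{i, j} = {a, b}" "i \<noteq> j"
        "x \<in> pverts H" "y \<in> pverts H"
      have "geodesic ?P u v [u, v]"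
        by (rule geodesic_edge) (use * in \<open>auto simp: doubleton_eq_iff\<close>)
      then show ?thesis by (intro exI[of _ "[u, v]"]) (simp add: vertex_proper_def)
    qed
  qed
  \<comment> \<open>Three elements \<open>x\<close>, \<open>y\<close>, \<open>z\<close> of
    \<open>H\<close> induce a 6-cycle in the product, on which vertices \<open>(i, x)\<close> and
    \<open>(j, x)\<close> are opposite. In each case the two paths are the two ways around this
    cycle: 2 and 4 edges on one side, 3 and 3 for an opposite pair, 1 and 5 for an adjacent
    pair.\<close>
  have conn2: "proper_vertex_2_connected ?P c"
    unfolding proper_vertex_2_connected_def
  proof (intro ballI impI)
    fix u v assume uv: "u \<in> pverts ?P" "v \<in> pverts ?P" "u \<noteq> v"
    show "\<exists>p q. p \<noteq> q \<and> path_between ?P u v p \<and> path_between ?P u v q \<and>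
         set (internal_verts p) \<inter> set (internal_verts q) = {} \<and>
         vertex_proper c p \<and> vertex_proper c q"
    proof (rule side_cases[OF uv])
      fix i j x y
      assume *: "u = (i, x)" "v = (i, y)" "x \<noteq> y" "{i, j} = {a, b}" "i \<noteq> j"
        "x \<in> pverts H" "y \<in> pverts H"
      obtain z where z: "z \<in> pverts H" "z \<noteq> x" "z \<noteq> y" using third by blast
      show ?thesis
        by (rule exI[of _ "[u, (j, z), v]"], rule exI[of _ "[u, (j, y), (i, z), (j, x), v]"])
          (use * z in \<open>auto simp: vertex_proper_def doubleton_eq_iff\<close>)
    next
      fix i j x
      assume *: "u = (i, x)" "v = (j, x)" "{i, j} = {a, b}" "i \<noteq> j" "x \<in> pverts H"
      obtain y where y: "y \<in> pverts H" "y \<noteq> x" using third by blast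
      obtain z where z: "z \<in> pverts H" "z \<noteq> x" "z \<noteq> y" using third by blast
      show ?thesis
        by (rule exI[of _ "[u, (j, y), (i, z), v]"], rule exI[of _ "[u, (j, z), (i, y), v]"])
          (use * y z in \<open>auto simp: vertex_proper_def doubleton_eq_iff\<close>)
    next
      fix i j x y
      assume *: "u = (i, x)" "v = (j, y)" "x \<noteq> y" "{i, j} = {a, b}" "i \<noteq> j"
        "x \<in> pverts H" "y \<in> pverts H"
      obtain z where z: "z \<in> pverts H" "z \<noteq> x" "z \<noteq> y" using third by blast
      show ?thesis
        by (rule exI[of _ "[u, v]"], rule exI[of _ "[u, (j, z), (i, y), (j, x), (i, z), v]"])
          (use * z in \<open>auto simp: vertex_proper_def doubleton_eq_iff\<close>)
    qed
  qed
  \<comment> \<open>Both lower bounds come from a proper path between \<open>(a, h)\<close> and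
    \<open>(b, h)\<close>. For \<open>spvc\<close> the same pair also shows that the product is not
    complete.\<close>
  have "spvc ?P = enat 2"
  proof (rule spvc_eqI[OF nonadj conn eq])
    fix c' assume "strong_proper_vertex_connected ?P c'"
    then obtain p where "geodesic ?P (a, h) (b, h) p" "vertex_proper c' p"
      using nonadj(1-3) unfolding strong_proper_vertex_connected_def by blast
    then show "2 \<le> card (c' ` pverts ?P)"
      by (intro ge) (auto simp: geodesic_def)
  qed
  then show "spvc ?P = 2" by (simp add: numeral_eq_enat)
  have "pvc2 ?P = enat 2"
  proof (rule pvc2_eqI[OF conn2 eq])
    fix c' assume "proper_vertex_2_connected ?P c'"
    then obtain p where "path_between ?P (a, h) (b, h) p" "vertex_proper c' p"
      using nonadj(1-3) unfolding proper_vertex_2_connected_def by blast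
    then show "2 \<le> card (c' ` pverts ?P)" by (rule ge)
  qed
  then show "pvc2 ?P = 2" by (simp add: numeral_eq_enat)
qed

theorem theorem6p4:
  fixes n m :: nat
    and Kn :: "'a pair_pre_digraph"
    and Km :: "'b pair_pre_digraph"
    and K2 :: "'c pair_pre_digraph"
  assumes "n \<ge> 3" and "m \<ge> 3"
    and "complete_digraph n (with_proj Kn)"
    and "complete_digraph m (with_proj Km)"
    and "complete_digraph 2 (with_proj K2)"
  shows "(spvc (Kn \<times>\<^sub>G Km) = 1 \<and> pvc2 (Kn \<times>\<^sub>G Km) = 1) \<and>
         (spvc (K2 \<times>\<^sub>G Km) = 2 \<and> pvc2 (K2 \<times>\<^sub>G Km) = 2)"
  using assms direct_product_complete_one_color[of n Kn m Km]
    direct_product_K2_complete_two_colors[of K2 m Km]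
  by simp

end
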